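(* Let $(c_n)_{n\ge0}$ be a sequence of nonzero numbers with $c_0=1$, let $\omega$ be an umbra with $\omega^n\simeq n!/c_n$, and let $\gamma,\alpha$ be umbrae. Let $n\ge k\ge0$ and let $m$ be an integer with $k\ge m$. Then \[ {}_{\omega}(\gamma,\alpha)_{n,k}\simeq\frac{c_n\,c_{k-m}}{c_k}\sum_{i=0}^{n-k}\frac{1}{c_{n-m-i}}\,\frac{(m.\alpha)^{i}}{i!}\;{}_{\omega}(\gamma,\alpha)_{n-m-i,k-m}. \]
   Context: Classical umbral calculus: $R=\mathbb{C}[x]$, $A$ a saturated alphabet of umbrae, $E:R[A]\to R$ linear with $E[1]=1$ and $E[\alpha^i\beta^j\cdots]=E[\alpha^i]E[\beta^j]\cdots$ for distinct umbrae; $p\simeq q$ means $E[p]=E[q]$. $f_\alpha(t)=\sum_n E[\alpha^n]t^n/n!$. For an integer $x$ (possibly negative), $x.\alpha$ is an umbra with $(x.\alpha)^n\simeq n![t^n]f_\alpha(t)^x$. The $\omega$-Riordan array ${}_\omega(\gamma,\alpha)$ is the lower triangular matrix with entries ${}_\omega(\gamma,\alpha)_{n,k}=E\!\left[\frac{c_n}{c_k}\frac{(\gamma+k.\alpha)^{n-k}}{(n-k)!}\right]$ for $n\ge k\ge0$, where $\gamma$ and $k.\alpha$ are uncorrelated. *)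

theory Defs
  imports
    "HOL-Library.Poly_Mapping"
    "HOL-Computational_Algebra.Polynomial"
    "HOL-Computational_Algebra.Formal_Power_Series"
begin

text \<open>
  The elements of the type \<open>'u\<close> are the umbrae (the alphabet \<open>A\<close>). The polynomial ring \<open>R[A]\<close>
  over \<open>R = \<complex>[x]\<close> is the monoid algebra over \<open>R\<close> of the finitely supported exponent functions.
\<close>

type_synonym 'u umbral_poly = "('u \<Rightarrow>\<^sub>0 nat) \<Rightarrow>\<^sub>0 complex poly"

definition umbra :: "'u \<Rightarrow> 'u umbral_poly" where
  "umbra u = Poly_Mapping.single (Poly_Mapping.single u 1) 1"

definition scalar :: "complex poly \<Rightarrow> 'u umbral_poly" where
  "scalar r = Poly_Mapping.single 0 r"

abbreviation cscalar :: "complex \<Rightarrow> 'u umbral_poly" where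
  "cscalar z \<equiv> scalar [:z:]"

text \<open>
  Saturation is meant in the sense of Rota and Taylor: every sequence in \<open>R\<close> starting with 1 is
  represented by infinitely many distinct umbrae.
\<close>

locale saturated_umbral_calculus =
  fixes E :: "'u umbral_poly \<Rightarrow> complex poly"
  assumes E_add: "E (p + q) = E p + E q"
    and E_scale: "E (scalar r * p) = r * E p"
    and E_one: "E 1 = 1"
    and E_uncorrelated:
      "finite U \<Longrightarrow> E (\<Prod>u\<in>U. umbra u ^ e u) = (\<Prod>u\<in>U. E (umbra u ^ e u))"
    and saturated: "a 0 = 1 \<Longrightarrow> infinite {u. \<forall>n. E (umbra u ^ n) = a n}"

definition umb_eq ::
    "('u umbral_poly \<Rightarrow> complex poly) \<Rightarrow> 'u umbral_poly \<Rightarrow> 'u umbral_poly \<Rightarrow> bool" where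
  "umb_eq E p q \<longleftrightarrow> E p = E q"

definition umbral_gf :: "('u umbral_poly \<Rightarrow> complex poly) \<Rightarrow> 'u \<Rightarrow> complex poly fps" where
  "umbral_gf E \<alpha> = Abs_fps (\<lambda>n. smult (1 / fact n) (E (umbra \<alpha> ^ n)))"

text \<open>
  Integer powers of a power series over \<open>\<complex>[x]\<close> with constant term 1. The library's \<open>inverse\<close> on
  power series is not available here because the coefficients do not form a field; the second
  argument of \<^term>\<open>fps_right_inverse\<close> is the inverse of the constant term.
\<close>

definition fps_int_power :: "complex poly fps \<Rightarrow> int \<Rightarrow> complex poly fps" where
  "fps_int_power f x = (if 0 \<le> x then f ^ nat x else fps_right_inverse f 1 ^ nat (- x))"

text \<open>\<open>\<delta>\<close> is an umbra \<open>x.\<alpha>\<close>; such an umbra is determined only up to its moments.\<close>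

definition is_dot ::
    "('u umbral_poly \<Rightarrow> complex poly) \<Rightarrow> int \<Rightarrow> 'u \<Rightarrow> 'u \<Rightarrow> bool" where
  "is_dot E x \<alpha> \<delta> \<longleftrightarrow>
     (\<forall>n. umb_eq E (umbra \<delta> ^ n)
            (scalar (fact n * fps_nth (fps_int_power (umbral_gf E \<alpha>) x) n)))"

text \<open>
  A representative of \<open>x.\<alpha>\<close> that is uncorrelated with (that is, distinct from) \<open>\<gamma>\<close>. It exists by
  saturation, and the array below does not depend on the choice; see \<open>ex_uncorrelated_dot\<close>
  and \<open>omega_riordan_eq\<close>.
\<close>

definition uncorrelated_dot ::
    "('u umbral_poly \<Rightarrow> complex poly) \<Rightarrow> 'u \<Rightarrow> int \<Rightarrow> 'u \<Rightarrow> 'u" where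
  "uncorrelated_dot E \<gamma> x \<alpha> = (SOME \<delta>. \<delta> \<noteq> \<gamma> \<and> is_dot E x \<alpha> \<delta>)"

definition omega_riordan ::
    "('u umbral_poly \<Rightarrow> complex poly) \<Rightarrow> (nat \<Rightarrow> complex) \<Rightarrow> 'u \<Rightarrow> 'u \<Rightarrow> nat \<Rightarrow> nat \<Rightarrow> complex poly"
  where
  "omega_riordan E c \<gamma> \<alpha> n k =
     (if k \<le> n
      then E (cscalar (c n / c k) * cscalar (1 / fact (n - k)) *
                (umbra \<gamma> + umbra (uncorrelated_dot E \<gamma> (int k) \<alpha>)) ^ (n - k))
      else 0)"

context saturated_umbral_calculus
begin

lemma E_scalar: "E (scalar r) = r"
  using E_scale[of r 1] by (simp add: E_one)

lemma fps_int_power_nth_0: "fps_nth (fps_int_power (umbral_gf E \<alpha>) x) 0 = 1"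
  by (simp add: fps_int_power_def umbral_gf_def fps_nth_power_0 E_one flip: one_pCons)

lemma ex_uncorrelated_dot: "\<exists>\<delta>. \<delta> \<noteq> \<gamma> \<and> is_dot E x \<alpha> \<delta>"
proof -
  let ?S = "{u. \<forall>n. E (umbra u ^ n) = fact n * fps_nth (fps_int_power (umbral_gf E \<alpha>) x) n}"
  have "infinite ?S"
    by (rule saturated) (simp add: fps_int_power_nth_0)
  then have "\<not> ?S \<subseteq> {\<gamma>}"
    using finite_subset by blast
  then show ?thesis
    by (auto simp: is_dot_def umb_eq_def E_scalar)
qed

lemma uncorrelated_dot:
  "uncorrelated_dot E \<gamma> x \<alpha> \<noteq> \<gamma>" "is_dot E x \<alpha> (uncorrelated_dot E \<gamma> x \<alpha>)"
  using someI_ex[OF ex_uncorrelated_dot[of \<gamma> x \<alpha>]] by (simp_all add: uncorrelated_dot_def)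

lemma E_zero: "E 0 = 0"
  using E_add[of 0 0] by simp

lemma E_sum: "E (\<Sum>i\<in>I. f i) = (\<Sum>i\<in>I. E (f i))"
  by (induction I rule: infinite_finite_induct) (simp_all add: E_zero E_add)

lemma of_nat_umbral_poly: "(of_nat n :: 'u umbral_poly) = scalar (of_nat n)"
  unfolding scalar_def by simp

lemma E_power_add:
  assumes "\<delta> \<noteq> \<gamma>"
  shows "E ((umbra \<gamma> + umbra \<delta>) ^ N) =
    (\<Sum>i\<le>N. of_nat (N choose i) * (E (umbra \<gamma> ^ i) * E (umbra \<delta> ^ (N - i))))"
proof -
  have "E (umbra \<gamma> ^ i * umbra \<delta> ^ j) = E (umbra \<gamma> ^ i) * E (umbra \<delta> ^ j)" for i j
    using E_uncorrelated[of "{\<gamma>, \<delta>}" "\<lambda>u. if u = \<gamma> then i else j"] assms by auto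
  then show ?thesis
    by (simp add: binomial_ring E_sum of_nat_umbral_poly E_scale mult.assoc)
qed

lemma omega_riordan_eq:
  assumes "k \<le> n" and "\<delta> \<noteq> \<gamma>" and "is_dot E (int k) \<alpha> \<delta>"
  shows "omega_riordan E c \<gamma> \<alpha> n k =
    E (cscalar (c n / c k) * cscalar (1 / fact (n - k)) * (umbra \<gamma> + umbra \<delta>) ^ (n - k))"
proof -
  have "E (umbra (uncorrelated_dot E \<gamma> (int k) \<alpha>) ^ j) = E (umbra \<delta> ^ j)" for j
    using assms(3) uncorrelated_dot(2)[where \<gamma> = \<gamma> and x = "int k" and \<alpha> = \<alpha>] by (simp add: is_dot_def umb_eq_def)
  then show ?thesis
    using assms(1,2) uncorrelated_dot(1)[where \<gamma> = \<gamma> and x = "int k" and \<alpha> = \<alpha>]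
    by (simp add: omega_riordan_def E_scale mult.assoc E_power_add)
qed

end

end

theory Submission
  imports Defs
begin

text \<open>
  The array entry with indices \<open>n, k\<close> is \<open>c\<^sub>n / c\<^sub>k\<close> times the coefficient of \<open>t\<^bsup>n - k\<^esup>\<close> in
  \<open>f\<^sub>\<gamma> f\<^sub>\<alpha>\<^bsup>k\<^esup>\<close>, so the identity is the Cauchy product for
  \<open>f\<^sub>\<gamma> f\<^sub>\<alpha>\<^bsup>k\<^esup> = f\<^sub>\<alpha>\<^bsup>m\<^esup> (f\<^sub>\<gamma> f\<^sub>\<alpha>\<^bsup>k - m\<^esup>)\<close>.
\<close>

lemma fps_int_power_mult_power:
  assumes "fps_nth f 0 = 1" and "m \<le> int k"
  shows "fps_int_power f m * f ^ nat (int k - m) = f ^ k"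
proof (cases "0 \<le> m")
  case True
  then have "nat m + nat (int k - m) = k"
    using assms(2) by simp
  with True show ?thesis
    by (simp add: fps_int_power_def flip: power_add)
next
  case False
  have "f * fps_right_inverse f 1 = 1"
    using assms(1) by (simp add: fps_right_inverse)
  moreover have "nat (int k - m) = nat (- m) + k"
    using False by simp
  ultimately show ?thesis
    using False
    by (simp add: fps_int_power_def power_add mult.commute mult.left_commute
        flip: mult.assoc power_mult_distrib)
qed

lemma smult_inverse_fact_mult_fact: "smult (1 / fact i) (fact i * p) = (p :: complex poly)"
proof -
  have "(fact i :: complex poly) = [:fact i:]"
    by (metis of_nat_fact of_nat_poly)
  then show ?thesis
    by simp
qed

context saturated_umbral_calculus
begin

lemma umbral_gf_nth_0: "fps_nth (umbral_gf E \<alpha>) 0 = 1"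
  by (simp add: umbral_gf_def E_one)

lemma E_umbra_power: "E (umbra \<alpha> ^ n) = fact n * fps_nth (umbral_gf E \<alpha>) n"
  using smult_inverse_fact_mult_fact[of n "E (umbra \<alpha> ^ n)"] by (simp add: umbral_gf_def)

lemma E_dot_power:
  assumes "is_dot E x \<alpha> \<delta>"
  shows "E (umbra \<delta> ^ n) = fact n * fps_nth (fps_int_power (umbral_gf E \<alpha>) x) n"
  using assms by (simp add: is_dot_def umb_eq_def E_scalar)

lemma omega_riordan_eq_fps_nth:
  assumes "k \<le> n"
  shows "omega_riordan E c \<gamma> \<alpha> n k =
    smult (c n / c k) (fps_nth (umbral_gf E \<gamma> * umbral_gf E \<alpha> ^ k) (n - k))"
proof -
  obtain \<delta> where \<delta>: "\<delta> \<noteq> \<gamma>" "is_dot E (int k) \<alpha> \<delta>"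
    using ex_uncorrelated_dot by blast
  have "E ((umbra \<gamma> + umbra \<delta>) ^ N) =
      fact N * fps_nth (umbral_gf E \<gamma> * umbral_gf E \<alpha> ^ k) N" for N
  proof -
    have "of_nat (N choose i) * (E (umbra \<gamma> ^ i) * E (umbra \<delta> ^ (N - i))) =
        fact N * (fps_nth (umbral_gf E \<gamma>) i * fps_nth (umbral_gf E \<alpha> ^ k) (N - i))"
      if "i \<le> N" for i
    proof -
      have "(fact N :: complex poly) = of_nat (fact i * fact (N - i) * (N choose i))"
        unfolding binomial_fact_lemma[OF that] by simp
      then show ?thesis
        by (simp add: E_umbra_power[of \<gamma>] E_dot_power[OF \<delta>(2)] fps_int_power_def mult_ac)
    qed
    then show ?thesis
      by (simp add: E_power_add[OF \<delta>(1)] fps_mult_nth sum_distrib_left atLeast0AtMost)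
  qed
  then show ?thesis
    by (simp add: omega_riordan_eq[OF assms \<delta>] mult.assoc E_scale smult_inverse_fact_mult_fact)
qed

end

theorem theorem3p17:
  fixes E :: "'u umbral_poly \<Rightarrow> complex poly"
    and c :: "nat \<Rightarrow> complex"
    and \<omega> \<gamma> \<alpha> \<mu> :: 'u
    and n k :: nat and m :: int
  assumes "saturated_umbral_calculus E"
    and "\<And>j. c j \<noteq> 0" and "c 0 = 1"
    and "\<And>j. umb_eq E (umbra \<omega> ^ j) (cscalar (fact j / c j))"
    and "k \<le> n" and "m \<le> int k"
    and "is_dot E m \<alpha> \<mu>"
  shows "umb_eq E (scalar (omega_riordan E c \<gamma> \<alpha> n k))
    (cscalar (c n * c (nat (int k - m)) / c k) *
      (\<Sum>i=0..n - k.
         cscalar (1 / c (nat (int n - m - int i))) *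
         (cscalar (1 / fact i) * umbra \<mu> ^ i) *
         scalar (omega_riordan E c \<gamma> \<alpha> (nat (int n - m - int i)) (nat (int k - m)))))"
proof -
  interpret saturated_umbral_calculus E
    by fact
  let ?f = "umbral_gf E \<alpha>" and ?g = "umbral_gf E \<gamma>"
  let ?l = "nat (int k - m)"
  let ?a = "fps_nth (fps_int_power ?f m)" and ?b = "fps_nth (?g * ?f ^ ?l)"
  have term_eq: "E (cscalar (1 / c (nat (int n - m - int i))) *
         (cscalar (1 / fact i) * umbra \<mu> ^ i) *
         scalar (omega_riordan E c \<gamma> \<alpha> (nat (int n - m - int i)) ?l)) =
      smult (1 / c ?l) (?a i * ?b (n - k - i))" if "i \<in> {0..n - k}" for i
  proof -
    let ?N = "nat (int n - m - int i)"
    have "?l \<le> ?N" and "?N - ?l = n - k - i"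
      using that assms(5,6) by auto
    then have riordan: "omega_riordan E c \<gamma> \<alpha> ?N ?l = smult (c ?N / c ?l) (?b (n - k - i))"
      by (simp add: omega_riordan_eq_fps_nth)
    have "E (cscalar (1 / c ?N) * (cscalar (1 / fact i) * umbra \<mu> ^ i) * scalar r) =
        smult (1 / c ?N) (?a i * r)" for r
    proof -
      have "E (cscalar (1 / c ?N) * (cscalar (1 / fact i) * umbra \<mu> ^ i) * scalar r) =
          E (scalar r * (cscalar (1 / c ?N) * (cscalar (1 / fact i) * umbra \<mu> ^ i)))"
        by (simp add: mult.commute)
      also have "\<dots> = r * smult (1 / c ?N) (?a i)"
        by (simp add: E_scale E_dot_power[OF assms(7)] smult_inverse_fact_mult_fact)
      finally show ?thesis
        by (simp add: mult.commute)
    qed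
    then show ?thesis
      using assms(2)[of ?N] by (simp add: riordan)
  qed
  have product: "?g * ?f ^ k = fps_int_power ?f m * (?g * ?f ^ ?l)"
    using fps_int_power_mult_power[OF umbral_gf_nth_0 assms(6)] by (metis mult.left_commute)
  have "omega_riordan E c \<gamma> \<alpha> n k =
      smult (c n / c k) (\<Sum>i=0..n - k. ?a i * ?b (n - k - i))"
    unfolding omega_riordan_eq_fps_nth[OF assms(5)] product
    by (subst fps_mult_nth) (rule refl)
  also have "\<dots> = smult (c n * c ?l / c k) (\<Sum>i=0..n - k. smult (1 / c ?l) (?a i * ?b (n - k - i)))"
  proof -
    have "(\<Sum>i=0..n - k. smult (1 / c ?l) (?a i * ?b (n - k - i))) =
        smult (1 / c ?l) (\<Sum>i=0..n - k. ?a i * ?b (n - k - i))"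
      using sum_distrib_left[of "[:1 / c ?l:]" "\<lambda>i. ?a i * ?b (n - k - i)" "{0..n - k}"]
      by simp
    then show ?thesis
      using assms(2)[of ?l] by simp
  qed
  finally show ?thesis
    by (simp add: umb_eq_def E_scalar E_scale E_sum term_eq)
qed

end
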